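(* Let $a>0$, $0\le b_{\min}<b_{\max}$, $k_1,k_2\in\mathbb{R}$ be constants, let $f\in C^1([0,a];\mathbb{R})$ satisfy $0\le f(x)\le x$ for all $x\in[0,a]$, and let $(x^*,u^*,v^* )\in(0,a)\times(b_{\min},b_{\max})\times[0,+\infty)$ satisfy $f(x^* )=u^*+v^*<a-x^*$. Put $\sigma:=k_1+k_2$ and consider the planar discrete-time system $(\ast)$ defined in the context, for which $(x^*,u^* )$ is an equilibrium point. Suppose that the equilibrium point $(x^*,u^* )$ of $(\ast)$ is locally exponentially stable. Moreover, suppose that $|k_2-q^2|<(|1-q|-1)^2$, where $q=\dfrac{\sigma+f'(x^* )}{2}\in(0,2)$. Define $$L:=\frac{(|1-q|-1)^2-|k_2-q^2|}{|q|+1-|1-q|},\qquad M:=\frac{|q|+1-|1-q|}{|q|(1-|1-q|)+|k_2-q^2|}.$$ Let $\eta>0$ be a constant for which $\max\{|f'(x)-f'(x^* )|:x\in[0,a],\ |x-x^*|\le\eta\}=L$ and such that $|f'(x)-f'(x^* )|<L$ for all $x\in[0,a]$ with $|x-x^*|<\eta$. Define $$\rho:=\min\left(\eta,\ \frac{\min(b_{\max}-u^*,\,u^*-b_{\min})}{\max\left(\dfrac{|1-2q+f'(x^* )|}{M},\ L+\big|k_2+(1-2q)q+(q-1)f'(x^* )\big|\right)},\ \frac{a-v^*-u^*-x^*}{1+L+|q-f'(x^* )|}\right).$$ Then every solution $(x(t),w(t))\in[0,a]\times\mathbb{R}$ of $(\ast)$ with initial condition $$(x(0),w(0))\in\Omega_\rho=\big\{(x,w)\in[0,a]\times\mathbb{R}:\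 |x-x^*|+M\,|w+v^*-f(x)+q(x-x^* )|<\rho\big\}$$ satisfies $\lim_{t\to+\infty}(x(t),w(t))=(x^*,u^* )$.
   Context: Let $P(s):=\max(b_{\min},\min(s,b_{\max}))$ for $s\in\mathbb{R}$. The system $(\ast)$, with state $(x,w)\in[0,a]\times\mathbb{R}$, is $$x(t+1)=x(t)-f(x(t))+\min\big(w(t)+v^*,\,a-x(t)\big),$$ $$w(t+1)=P\Big(w(t)+\sigma f(x(t))-\sigma\min\big(w(t)+v^*,\,a-x(t)\big)-k_2(x(t)-x^* )\Big).$$ A solution is a sequence $(x(t),w(t))_{t\ge0}$ in $[0,a]\times\mathbb{R}$ satisfying these equations for all $t\ge0$. The equilibrium $(x^*,u^* )$ is locally exponentially stable if there are $\delta>0$, $C\ge1$, $\mu\in(0,1)$ such that every solution with $|(x(0)-x^*,w(0)-u^* )|<\delta$ satisfies $|(x(t)-x^*,w(t)-u^* )|\le C\mu^t|(x(0)-x^*,w(0)-u^* )|$ for all $t\ge0$. *)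

theory Defs
  imports "HOL-Analysis.Analysis"
begin

definition clamp_to :: "real \<Rightarrow> real \<Rightarrow> real \<Rightarrow> real" where
  "clamp_to bmin bmax s = max bmin (min s bmax)"

definition system_step ::
  "real \<Rightarrow> real \<Rightarrow> real \<Rightarrow> real \<Rightarrow> real \<Rightarrow> (real \<Rightarrow> real) \<Rightarrow> real \<Rightarrow> real \<Rightarrow> real \<times> real \<Rightarrow> real \<times> real" where
  "system_step a bmin bmax \<sigma> k\<^sub>2 f xs vs = (\<lambda>(x, w).
     (x - f x + min (w + vs) (a - x),
      clamp_to bmin bmax
        (w + \<sigma> * f x - \<sigma> * min (w + vs) (a - x) - k\<^sub>2 * (x - xs))))"

text \<open>
  The step need not map \<open>{0..a} \<times> UNIV\<close> into itself (the second component may be very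
  negative initially), so membership of the state space is required at every time.
\<close>

definition solutions ::
  "real \<Rightarrow> real \<Rightarrow> real \<Rightarrow> real \<Rightarrow> real \<Rightarrow> (real \<Rightarrow> real) \<Rightarrow> real \<Rightarrow> real \<Rightarrow> (nat \<Rightarrow> real \<times> real) set" where
  "solutions a bmin bmax \<sigma> k\<^sub>2 f xs vs =
     {z. \<forall>t. z t \<in> {0..a} \<times> UNIV \<and> z (Suc t) = system_step a bmin bmax \<sigma> k\<^sub>2 f xs vs (z t)}"

definition locally_exponentially_stable ::
  "(nat \<Rightarrow> 'a::real_normed_vector) set \<Rightarrow> 'a \<Rightarrow> bool" where
  "locally_exponentially_stable S e \<longleftrightarrow>
     (\<exists>\<delta>>0. \<exists>C\<ge>1. \<exists>\<mu>\<in>{0<..<1}. \<forall>z\<in>S.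
        norm (z 0 - e) < \<delta> \<longrightarrow> (\<forall>t. norm (z t - e) \<le> C * \<mu> ^ t * norm (z 0 - e)))"

text \<open>\<open>Max\<close> is only meaningful for finite sets; this is the maximum of an arbitrary set.\<close>

definition is_maximum :: "real set \<Rightarrow> real \<Rightarrow> bool" where
  "is_maximum A m \<longleftrightarrow> m \<in> A \<and> (\<forall>y\<in>A. y \<le> m)"

definition Omega ::
  "real \<Rightarrow> (real \<Rightarrow> real) \<Rightarrow> real \<Rightarrow> real \<Rightarrow> real \<Rightarrow> real \<Rightarrow> real \<Rightarrow> (real \<times> real) set" where
  "Omega a f xs vs q M \<rho> =
     {(x, w). x \<in> {0..a} \<and> \<bar>x - xs\<bar> + M * \<bar>w + vs - f x + q * (x - xs)\<bar> < \<rho>}"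

end

theory Submission
  imports Defs
begin

text \<open>
  Put \<open>y = x - xs\<close> and \<open>e = w + vs - f x + q * y\<close>. As long as neither the minimum nor the
  projection is active, the step reads \<open>y' = (1 - q) * y + e\<close> and
  \<open>e' = (1 - q) * e + (q\<^sup>2 - k\<^sub>2) * y - r\<close>, where \<open>r\<close> is the error of the linearization of \<open>f\<close>
  with slope \<open>f' xs\<close> between \<open>x\<close> and the next state. The constants \<open>L\<close> and \<open>M\<close> are the ones
  for which \<open>V = \<bar>y\<bar> + M * \<bar>e\<bar>\<close> cannot increase when \<open>\<bar>r\<bar> \<le> L * \<bar>x' - x\<bar>\<close>. On the sublevel set
  of \<open>V\<close> through the initial state \<open>\<bar>f' - f' xs\<bar>\<close> is at most some \<open>B < L\<close> by compactness, so
  \<open>V\<close> decays geometrically. The bound \<open>\<rho>\<close> keeps the constraints inactive on that set.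
\<close>

text \<open>Mean value inequality for \<open>f x - c * x\<close>, whose derivative
  \<open>f' - c\<close> is bounded by \<open>B\<close>.\<close>

lemma linearization_error_le:
  fixes f f' :: "real \<Rightarrow> real"
  assumes "convex S"
    and "\<And>x. x \<in> S \<Longrightarrow> (f has_real_derivative f' x) (at x within S)"
    and "\<And>x. x \<in> S \<Longrightarrow> \<bar>f' x - c\<bar> \<le> B"
    and "x \<in> S" "y \<in> S"
  shows "\<bar>f x - f y - c * (x - y)\<bar> \<le> B * \<bar>x - y\<bar>"
proof -
  have "norm ((f x - c * x) - (f y - c * y)) \<le> B * norm (x - y)"
  proof (rule field_differentiable_bound[OF \<open>convex S\<close>])
    show "((\<lambda>x. f x - c * x) has_field_derivative f' u - c) (at u within S)" if "u \<in> S" for u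
      by (auto intro!: derivative_eq_intros assms(2) that)
  qed (use assms in auto)
  then show ?thesis by (simp add: algebra_simps)
qed

lemma abs_diff_add_le:
  fixes u v w :: real
  shows "\<bar>u - v + w\<bar> \<le> \<bar>u\<bar> + \<bar>v\<bar> + \<bar>w\<bar>"
  by linarith

text \<open>The matrix with rows \<open>(p, 1)\<close> and \<open>(\<kappa> + L * q, p + L)\<close>
  dominates one step of \<open>(\<bar>y\<bar>, \<bar>e\<bar>)\<close> when the slope error is
  \<open>L\<close>. This \<open>L\<close> is where 1 becomes an eigenvalue, and
  \<open>(1, M)\<close> is a left eigenvector for it; the last two identities are its
  components.\<close>

lemma weight_identities:
  fixes p q \<kappa> L M :: real
  assumes "0 \<le> p" "p < 1" "q > 0" "0 \<le> \<kappa>" "\<kappa> < (1 - p)\<^sup>2"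
    and L: "L = ((1 - p)\<^sup>2 - \<kappa>) / (q + 1 - p)"
    and M: "M = (q + 1 - p) / (q * (1 - p) + \<kappa>)"
  shows "L > 0" "M \<ge> 1" "1 = M * (1 - p - L)" "M * (\<kappa> + L * q) = 1 - p"
proof -
  have s: "q + 1 - p > 0" using assms by simp
  have "q * (1 - p) > 0" using assms by simp
  then have d: "q * (1 - p) + \<kappa> > 0" using assms by linarith
  show "L > 0" unfolding L using s assms by simp
  have Ls: "L * (q + 1 - p) = (1 - p)\<^sup>2 - \<kappa>" using L s by simp
  have "(1 - p - L) * (q + 1 - p) = q * (1 - p) + \<kappa>"
    using Ls by (simp add: algebra_simps power2_eq_square)
  then have "1 - p - L = (q * (1 - p) + \<kappa>) / (q + 1 - p)"
    using s by (simp add: eq_divide_eq)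
  then show M1: "1 = M * (1 - p - L)" unfolding M using s d by simp
  have "M > 0" unfolding M using s d by simp
  have "M * (1 - p - L) \<le> M * 1"
    using \<open>M > 0\<close> \<open>L > 0\<close> \<open>0 \<le> p\<close> by (intro mult_left_mono) auto
  then show "M \<ge> 1" using M1 by simp
  have "\<kappa> + L * q = (1 - p) * (1 - p - L)"
    using Ls by (simp add: algebra_simps power2_eq_square)
  then show "M * (\<kappa> + L * q) = 1 - p"
    using M1 by (metis mult.left_commute mult.right_neutral)
qed

text \<open>With slope error \<open>L\<close> the eigenvector relation only gives a nonincreasing
  norm. Lowering it to \<open>B\<close> saves
  \<open>(L - B) * M * (\<bar>e\<bar> + q * \<bar>y\<bar>)\<close>, at least a fixed multiple of the
  norm when \<open>B < L\<close>. The \<open>max 0\<close> keeps the factor nonnegative, as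
  \<open>geometric_decay_tendsto_zero\<close> requires.\<close>

lemma weighted_norm_contraction:
  fixes p q \<kappa> L M B y e y' e' :: real
  assumes "M \<ge> 1" "q > 0" "B \<le> L"
    and M1: "1 = M * (1 - p - L)" and M2: "M * (\<kappa> + L * q) = 1 - p"
    and y': "\<bar>y'\<bar> \<le> p * \<bar>y\<bar> + \<bar>e\<bar>"
    and e': "\<bar>e'\<bar> \<le> p * \<bar>e\<bar> + \<kappa> * \<bar>y\<bar> + B * (\<bar>e\<bar> + q * \<bar>y\<bar>)"
  shows "\<bar>y'\<bar> + M * \<bar>e'\<bar> \<le> max 0 (1 - (L - B) * min 1 (M * q)) * (\<bar>y\<bar> + M * \<bar>e\<bar>)"
proof -
  let ?V = "\<bar>y\<bar> + M * \<bar>e\<bar>"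
  have "M * \<bar>e'\<bar> \<le> M * (p * \<bar>e\<bar> + \<kappa> * \<bar>y\<bar> + B * (\<bar>e\<bar> + q * \<bar>y\<bar>))"
    using e' \<open>M \<ge> 1\<close> by (intro mult_left_mono) auto
  \<comment> \<open>The coefficient 1 of \<open>\<bar>e\<bar>\<close> is spelled out so that
    \<open>M1\<close> can rewrite it.\<close>
  with y' have "\<bar>y'\<bar> + M * \<bar>e'\<bar>
      \<le> p * \<bar>y\<bar> + 1 * \<bar>e\<bar> + M * (p * \<bar>e\<bar> + \<kappa> * \<bar>y\<bar> + B * (\<bar>e\<bar> + q * \<bar>y\<bar>))"
    by linarith
  also have "\<dots> = (p + M * (\<kappa> + L * q)) * \<bar>y\<bar> + M * (1 - p - L) * \<bar>e\<bar> + M * (p + L) * \<bar>e\<bar>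
      - (L - B) * (M * \<bar>e\<bar> + M * q * \<bar>y\<bar>)"
    by (subst M1) (simp add: algebra_simps)
  also have "\<dots> = ?V - (L - B) * (M * \<bar>e\<bar> + M * q * \<bar>y\<bar>)"
    unfolding M2 by (simp add: algebra_simps)
  also have "\<dots> \<le> ?V - (L - B) * (min 1 (M * q) * ?V)"
  proof -
    have "min 1 (M * q) * \<bar>y\<bar> \<le> M * q * \<bar>y\<bar>" by (intro mult_right_mono) auto
    moreover have "min 1 (M * q) * (M * \<bar>e\<bar>) \<le> 1 * (M * \<bar>e\<bar>)"
      using \<open>M \<ge> 1\<close> by (intro mult_right_mono) auto
    ultimately have "min 1 (M * q) * ?V \<le> M * \<bar>e\<bar> + M * q * \<bar>y\<bar>"
      by (simp add: distrib_left)
    with \<open>B \<le> L\<close> show ?thesis by (intro diff_left_mono mult_left_mono) auto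
  qed
  also have "\<dots> = (1 - (L - B) * min 1 (M * q)) * ?V" by (simp add: algebra_simps)
  also have "\<dots> \<le> max 0 (1 - (L - B) * min 1 (M * q)) * ?V"
    using \<open>M \<ge> 1\<close> by (intro mult_right_mono) auto
  finally show ?thesis .
qed

lemma geometric_decay_tendsto_zero:
  fixes V :: "nat \<Rightarrow> real"
  assumes "\<And>t. 0 \<le> V t" and "0 \<le> \<theta>" "\<theta> < 1" and "\<And>t. V (Suc t) \<le> \<theta> * V t"
  shows "V \<longlonglongrightarrow> 0"
proof (rule Lim_null_comparison)
  have "V t \<le> \<theta> ^ t * V 0" for t
  proof (induction t)
    case (Suc t)
    have "V (Suc t) \<le> \<theta> * (\<theta> ^ t * V 0)"
      using assms(4)[of t] mult_left_mono[OF Suc assms(2)] by linarith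
    then show ?case by (simp add: mult.assoc)
  qed simp
  then show "\<forall>\<^sub>F t in sequentially. norm (V t) \<le> \<theta> ^ t * V 0"
    using assms(1) by simp
  show "(\<lambda>t. \<theta> ^ t * V 0) \<longlonglongrightarrow> 0"
    using assms(2,3) by (intro tendsto_mult_left_zero LIMSEQ_realpow_zero) auto
qed

lemma system_step_unsaturated:
  assumes "w + vs \<le> a - x"
    and "w + \<sigma> * f x - \<sigma> * (w + vs) - k\<^sub>2 * (x - xs) \<in> {bmin..bmax}"
  shows "system_step a bmin bmax \<sigma> k\<^sub>2 f xs vs (x, w) =
    (x - f x + (w + vs), w + \<sigma> * f x - \<sigma> * (w + vs) - k\<^sub>2 * (x - xs))"
  using assms by (simp add: system_step_def clamp_to_def)

theorem proposition2p1:
  fixes a bmin bmax k\<^sub>1 k\<^sub>2 xs us vs \<sigma> q L M \<eta> \<rho> :: real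
    and f f' :: "real \<Rightarrow> real"
    and z :: "nat \<Rightarrow> real \<times> real"
  assumes "a > 0" and "0 \<le> bmin" and "bmin < bmax"
    and f_deriv: "\<And>x. x \<in> {0..a} \<Longrightarrow> (f has_real_derivative f' x) (at x within {0..a})"
    and f'_cont: "continuous_on {0..a} f'"
    and f_bounds: "\<And>x. x \<in> {0..a} \<Longrightarrow> 0 \<le> f x \<and> f x \<le> x"
    and "xs \<in> {0<..<a}" and "us \<in> {bmin<..<bmax}" and "vs \<ge> 0"
    and "f xs = us + vs" and "us + vs < a - xs"
    and \<sigma>: "\<sigma> = k\<^sub>1 + k\<^sub>2"
    and stable: "locally_exponentially_stable (solutions a bmin bmax \<sigma> k\<^sub>2 f xs vs) (xs, us)"
    and q: "q = (\<sigma> + f' xs) / 2" and "q \<in> {0<..<2}"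
    and "\<bar>k\<^sub>2 - q\<^sup>2\<bar> < (\<bar>1 - q\<bar> - 1)\<^sup>2"
    and L: "L = ((\<bar>1 - q\<bar> - 1)\<^sup>2 - \<bar>k\<^sub>2 - q\<^sup>2\<bar>) / (\<bar>q\<bar> + 1 - \<bar>1 - q\<bar>)"
    and M: "M = (\<bar>q\<bar> + 1 - \<bar>1 - q\<bar>) / (\<bar>q\<bar> * (1 - \<bar>1 - q\<bar>) + \<bar>k\<^sub>2 - q\<^sup>2\<bar>)"
    and "\<eta> > 0"
    and \<eta>_max: "is_maximum {\<bar>f' x - f' xs\<bar> | x. x \<in> {0..a} \<and> \<bar>x - xs\<bar> \<le> \<eta>} L"
    and \<eta>_less: "\<And>x. x \<in> {0..a} \<Longrightarrow> \<bar>x - xs\<bar> < \<eta> \<Longrightarrow> \<bar>f' x - f' xs\<bar> < L"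
    and \<rho>: "\<rho> = min \<eta> (min
        (min (bmax - us) (us - bmin) /
           max (\<bar>1 - 2 * q + f' xs\<bar> / M)
               (L + \<bar>k\<^sub>2 + (1 - 2 * q) * q + (q - 1) * f' xs\<bar>))
        ((a - vs - us - xs) / (1 + L + \<bar>q - f' xs\<bar>)))"
    and z: "z \<in> solutions a bmin bmax \<sigma> k\<^sub>2 f xs vs"
    and z0: "z 0 \<in> Omega a f xs vs q M \<rho>"
  shows "z \<longlonglongrightarrow> (xs, us)"
proof -
  define c where "c = f' xs"
  define p where "p = \<bar>1 - q\<bar>"
  define \<kappa> where "\<kappa> = \<bar>k\<^sub>2 - q\<^sup>2\<bar>"
  \<comment> \<open>\<open>- K\<close> will be the coefficient of \<open>y\<close> in the deviation
    of the unprojected input from \<open>us\<close>; \<open>D\<close> and \<open>E\<close> are the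
    denominators in \<open>\<rho>\<close>.\<close>
  define K where "K = k\<^sub>2 + (1 - 2 * q) * q + (q - 1) * c"
  define D where "D = max (\<bar>1 - 2 * q + c\<bar> / M) (L + \<bar>K\<bar>)"
  define E where "E = 1 + L + \<bar>q - c\<bar>"
  define x where "x t = fst (z t)" for t
  define w where "w t = snd (z t)" for t
  define y where "y t = x t - xs" for t
  define e where "e t = w t + vs - f (x t) + q * y t" for t
  define V where "V t = \<bar>y t\<bar> + M * \<bar>e t\<bar>" for t
  have zt: "z t = (x t, w t)" for t by (simp add: x_def w_def)
  have q0: "q > 0" using \<open>q \<in> {0<..<2}\<close> by simp
  have p: "0 \<le> p" "p < 1" unfolding p_def using \<open>q \<in> {0<..<2}\<close> by auto
  have "(p - 1)\<^sup>2 = (1 - p)\<^sup>2" by (rule power2_commute)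
  then have "\<kappa> < (1 - p)\<^sup>2" "L = ((1 - p)\<^sup>2 - \<kappa>) / (q + 1 - p)"
    "M = (q + 1 - p) / (q * (1 - p) + \<kappa>)"
    using \<open>\<bar>k\<^sub>2 - q\<^sup>2\<bar> < _\<close> L M q0 by (simp_all add: p_def \<kappa>_def)
  from weight_identities[OF p q0 _ this]
  have L0: "L > 0" and M_ge: "M \<ge> 1" and M1: "1 = M * (1 - p - L)"
    and M2: "M * (\<kappa> + L * q) = 1 - p"
    by (simp_all add: \<kappa>_def)
  have D0: "D > 0" unfolding D_def using L0 by linarith
  have E1: "E \<ge> 1" unfolding E_def using L0 by linarith
  have \<rho>_le: "\<rho> \<le> \<eta>" "D * \<rho> \<le> min (bmax - us) (us - bmin)" "E * \<rho> \<le> a - vs - us - xs"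
  proof -
    have \<rho>': "\<rho> = min \<eta> (min (min (bmax - us) (us - bmin) / D) ((a - vs - us - xs) / E))"
      by (simp add: \<rho> D_def E_def K_def c_def)
    show "\<rho> \<le> \<eta>" by (simp add: \<rho>')
    have "\<rho> \<le> min (bmax - us) (us - bmin) / D" "\<rho> \<le> (a - vs - us - xs) / E"
      unfolding \<rho>' by auto
    then show "D * \<rho> \<le> min (bmax - us) (us - bmin)" "E * \<rho> \<le> a - vs - us - xs"
      using D0 E1 by (simp_all add: pos_le_divide_eq mult.commute)
  qed
  have xI: "x t \<in> {0..a}" and step: "z (Suc t) = system_step a bmin bmax \<sigma> k\<^sub>2 f xs vs (z t)" for t
    using z by (auto simp: solutions_def x_def mem_Times_iff)
  have V\<rho>: "V 0 < \<rho>" using z0 by (simp add: Omega_def zt V_def y_def e_def)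
  have V_nonneg: "0 \<le> V t" for t using M_ge by (simp add: V_def)
  \<comment> \<open>The radius is \<open>V 0\<close>, not \<open>\<rho>\<close>: the interval is
    closed, yet lies strictly inside the \<open>\<eta>\<close>-neighbourhood, where the slope error
    is below \<open>L\<close>. Compactness then yields a uniform gap.\<close>
  define S where "S = {0..a} \<inter> cball xs (V 0)"
  have S_iff: "u \<in> S \<longleftrightarrow> u \<in> {0..a} \<and> \<bar>u - xs\<bar> \<le> V 0" for u
    by (auto simp: S_def dist_real_def abs_minus_commute)
  have xs_S: "xs \<in> S" using S_iff V_nonneg[of 0] \<open>xs \<in> {0<..<a}\<close> by auto
  obtain B where B: "B < L" "\<And>u. u \<in> S \<Longrightarrow> \<bar>f' u - c\<bar> \<le> B"
  proof -
    have "compact S" unfolding S_def by (intro compact_Int_closed) auto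
    moreover have "continuous_on S (\<lambda>u. \<bar>f' u - c\<bar>)"
      using f'_cont by (intro continuous_intros) (auto simp: S_def elim: continuous_on_subset)
    ultimately obtain m where "m \<in> S" "\<forall>u\<in>S. \<bar>f' u - c\<bar> \<le> \<bar>f' m - c\<bar>"
      using continuous_attains_sup[of S] xs_S by blast
    moreover have "\<bar>f' m - c\<bar> < L"
      unfolding c_def using \<eta>_less[of m] \<open>m \<in> S\<close> S_iff V\<rho> \<rho>_le(1) by auto
    ultimately show ?thesis using that by blast
  qed
  have lin: "\<bar>f u - f v - c * (u - v)\<bar> \<le> B * \<bar>u - v\<bar>" if "u \<in> S" "v \<in> S" for u v
  proof (rule linearization_error_le[of S f f'])
    show "convex S" unfolding S_def by (intro convex_Int) auto
    show "(f has_real_derivative f' s) (at s within S)" if "s \<in> S" for s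
      using f_deriv[of s] that by (auto simp: S_def intro: DERIV_subset)
  qed (use B that in auto)
  define \<theta> where "\<theta> = max 0 (1 - (L - B) * min 1 (M * q))"
  have "0 < (L - B) * min 1 (M * q)" using B(1) M_ge q0 by (intro mult_pos_pos) auto
  then have \<theta>: "0 \<le> \<theta>" "\<theta> < 1" by (auto simp: \<theta>_def)
  \<comment> \<open>The hypothesis keeps the state in \<open>S\<close> and both constraints
    inactive; the induction for \<open>V_le\<close> supplies it at every time.\<close>
  have V_step: "V (Suc t) \<le> \<theta> * V t" if Vt: "V t \<le> V 0" for t
  proof -
    have e_le: "\<bar>e t\<bar> \<le> M * \<bar>e t\<bar>" using mult_right_mono[OF M_ge, of "\<bar>e t\<bar>"] by simp
    have "\<bar>y t\<bar> \<le> V t" using M_ge by (simp add: V_def)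
    then have xS: "x t \<in> S" using S_iff xI Vt by (auto simp: y_def)
    \<comment> \<open>\<open>g\<close> is the linearization error relative to the equilibrium. It is
      bounded with \<open>L\<close> rather than \<open>B\<close> because \<open>\<rho>\<close> is
      built from \<open>L\<close>.\<close>
    define g where "g = f (x t) - f xs - c * y t"
    have g: "\<bar>g\<bar> \<le> L * \<bar>y t\<bar>"
      using lin[OF xS xs_S] mult_right_mono[of B L "\<bar>y t\<bar>"] B(1)
      unfolding g_def y_def by linarith
    have f_eq: "f (x t) = us + vs + c * y t + g" using \<open>f xs = us + vs\<close> by (simp add: g_def)
    have w_eq: "w t = f (x t) - vs - q * y t + e t" by (simp add: e_def)
    have x_eq: "x t = xs + y t" by (simp add: y_def)
    have unsat1: "w t + vs \<le> a - x t"
    proof -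
      \<comment> \<open>The left side is the deviation of \<open>w + vs + x\<close> from its
        equilibrium value, so \<open>E * \<rho>\<close>, at most the slack
        \<open>a - vs - us - xs\<close>, must dominate it.\<close>
      have "w t + vs + x t - (us + vs + xs) = y t + g + (c - q) * y t + e t"
        unfolding w_eq f_eq by (simp add: x_eq algebra_simps)
      also have "\<dots> \<le> \<bar>y t\<bar> + L * \<bar>y t\<bar> + \<bar>q - c\<bar> * \<bar>y t\<bar> + \<bar>e t\<bar>"
        using g abs_ge_self[of "(c - q) * y t"] abs_ge_self[of "e t"]
          abs_ge_self[of "y t"] abs_ge_self[of g]
        unfolding abs_mult abs_minus_commute[of c q] by linarith
      also have "\<dots> \<le> E * \<bar>y t\<bar> + E * (M * \<bar>e t\<bar>)"
        using e_le mult_right_mono[OF E1, of "M * \<bar>e t\<bar>"] M_ge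
        by (simp add: E_def algebra_simps)
      also have "\<dots> = E * V t" by (simp add: V_def distrib_left)
      also have "\<dots> \<le> E * \<rho>" using Vt V\<rho> E1 by (intro mult_left_mono) auto
      finally show ?thesis using \<rho>_le(3) by linarith
    qed
    have \<sigma>_eq: "\<sigma> = 2 * q - c" using q by (simp add: c_def)
    \<comment> \<open>\<open>s\<close> is the next input before projection.\<close>
    define s where "s = w t + \<sigma> * f (x t) - \<sigma> * (w t + vs) - k\<^sub>2 * y t"
    have "s - us = g - K * y t + (1 - 2 * q + c) * e t"
      unfolding s_def w_eq f_eq \<sigma>_eq K_def by (simp add: algebra_simps)
    also have "\<bar>\<dots>\<bar> \<le> \<bar>g\<bar> + \<bar>K * y t\<bar> + \<bar>(1 - 2 * q + c) * e t\<bar>"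
      by (rule abs_diff_add_le)
    also have "\<dots> \<le> L * \<bar>y t\<bar> + \<bar>K\<bar> * \<bar>y t\<bar> + \<bar>1 - 2 * q + c\<bar> * \<bar>e t\<bar>"
      unfolding abs_mult by (intro add_right_mono g)
    \<comment> \<open>\<open>V\<close> measures the error as \<open>M * \<bar>e\<bar>\<close>, hence
      the division by \<open>M\<close> in the first argument of the maximum
      \<open>D\<close>.\<close>
    also have "\<dots> = (L + \<bar>K\<bar>) * \<bar>y t\<bar> + (\<bar>1 - 2 * q + c\<bar> / M) * (M * \<bar>e t\<bar>)"
      using M_ge by (simp add: distrib_right)
    also have "\<dots> \<le> D * \<bar>y t\<bar> + D * (M * \<bar>e t\<bar>)"
      unfolding D_def using M_ge by (intro add_mono mult_right_mono) auto
    also have "\<dots> = D * V t" by (simp add: V_def distrib_left)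
    also have "\<dots> \<le> D * \<rho>" using Vt V\<rho> D0 by (intro mult_left_mono) auto
    finally have unsat2: "s \<in> {bmin..bmax}" using \<rho>_le(2) by auto
    have "z (Suc t) = (x t - f (x t) + (w t + vs), s)"
      using step[of t] system_step_unsaturated[OF unsat1, of \<sigma> f k\<^sub>2 xs bmin bmax] unsat2
      by (simp add: s_def zt y_def)
    then have x': "x (Suc t) = x t - f (x t) + (w t + vs)" and w': "w (Suc t) = s"
      by (simp_all add: zt)
    have dx: "x (Suc t) - x t = e t - q * y t" unfolding x' w_eq by simp
    have y_eq: "y (Suc t) = (1 - q) * y t + e t"
      using dx by (simp add: y_def algebra_simps)
    then have y': "\<bar>y (Suc t)\<bar> \<le> p * \<bar>y t\<bar> + \<bar>e t\<bar>"
      using abs_triangle_ineq[of "(1 - q) * y t" "e t"] by (simp add: p_def abs_mult)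
    \<comment> \<open>The next position must be in \<open>S\<close> before the slope bound
      \<open>B\<close> can be applied between the two positions; the estimate of \<open>y\<close>
      alone gives this, without the decay of \<open>V\<close>.\<close>
    have "p * \<bar>y t\<bar> \<le> 1 * \<bar>y t\<bar>" using p by (intro mult_right_mono) auto
    then have "\<bar>y (Suc t)\<bar> \<le> V 0" using y' e_le Vt by (simp add: V_def)
    then have xS': "x (Suc t) \<in> S" using S_iff xI by (auto simp: y_def)
    \<comment> \<open>Unlike \<open>g\<close>, this error compares consecutive positions, so it
      scales with their distance \<open>\<bar>e t - q * y t\<bar>\<close>.\<close>
    define r where "r = f (x (Suc t)) - f (x t) - c * (x (Suc t) - x t)"
    have "\<bar>r\<bar> \<le> B * \<bar>e t - q * y t\<bar>" using lin[OF xS' xS] by (simp add: r_def dx)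
    also have "\<dots> \<le> B * (\<bar>e t\<bar> + q * \<bar>y t\<bar>)"
    proof (rule mult_left_mono)
      show "\<bar>e t - q * y t\<bar> \<le> \<bar>e t\<bar> + q * \<bar>y t\<bar>"
        using abs_triangle_ineq4[of "e t" "q * y t"] q0 by (simp add: abs_mult)
      show "0 \<le> B" using B(2)[OF xs_S] by (simp add: c_def)
    qed
    finally have r: "\<bar>r\<bar> \<le> B * (\<bar>e t\<bar> + q * \<bar>y t\<bar>)" .
    have f': "f (x (Suc t)) = f (x t) + c * (e t - q * y t) + r" by (simp add: r_def dx)
    \<comment> \<open>\<open>\<sigma>\<close> and \<open>c\<close> enter only through their sum
      \<open>2 * q\<close>; the shift \<open>q * y\<close> in \<open>e\<close> then leaves
      \<open>1 - q\<close> on both diagonal entries.\<close>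
    have "e (Suc t) = (1 - q) * e t - (k\<^sub>2 - q\<^sup>2) * y t - r"
      unfolding e_def[of "Suc t"] w' f' y_eq s_def \<sigma>_eq w_eq
      by (simp add: algebra_simps power2_eq_square)
    then have "\<bar>e (Suc t)\<bar> \<le> p * \<bar>e t\<bar> + \<kappa> * \<bar>y t\<bar> + \<bar>r\<bar>"
      using abs_diff_add_le[of "(1 - q) * e t" "(k\<^sub>2 - q\<^sup>2) * y t" "- r"]
      by (simp add: p_def \<kappa>_def abs_mult)
    then have "\<bar>e (Suc t)\<bar> \<le> p * \<bar>e t\<bar> + \<kappa> * \<bar>y t\<bar> + B * (\<bar>e t\<bar> + q * \<bar>y t\<bar>)"
      using r by linarith
    with weighted_norm_contraction[OF M_ge q0 _ M1 M2 y'] B(1) show ?thesis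
      by (simp add: V_def \<theta>_def)
  qed
  have V_le: "V t \<le> V 0" for t
  proof (induction t)
    case (Suc t)
    have "\<theta> * V t \<le> 1 * V t" using \<theta> V_nonneg by (intro mult_right_mono) auto
    then show ?case using V_step[OF Suc] Suc by linarith
  qed simp
  have V_lim: "V \<longlonglongrightarrow> 0"
    by (rule geometric_decay_tendsto_zero[of V, OF V_nonneg \<theta> V_step[OF V_le]])
  have y_lim: "y \<longlonglongrightarrow> 0"
    by (rule Lim_null_comparison[OF _ V_lim]) (use M_ge in \<open>simp add: V_def\<close>)
  have e_lim: "e \<longlonglongrightarrow> 0"
  proof (rule Lim_null_comparison[OF _ V_lim], intro always_eventually allI)
    show "norm (e t) \<le> V t" for t
      using mult_right_mono[OF M_ge, of "\<bar>e t\<bar>"] by (simp add: V_def)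
  qed
  have x_lim: "x \<longlonglongrightarrow> xs"
    using y_lim unfolding y_def by (simp add: LIM_zero_iff)
  \<comment> \<open>Continuity of \<open>f\<close> turns the limits of \<open>x\<close>,
    \<open>y\<close> and \<open>e\<close> into the limit of \<open>w\<close>.\<close>
  have "continuous_on {0..a} f" using f_deriv by (rule DERIV_continuous_on)
  then have "(\<lambda>t. f (x t)) \<longlonglongrightarrow> f xs"
    by (rule continuous_on_tendsto_compose[OF _ x_lim]) (use xI \<open>xs \<in> {0<..<a}\<close> in auto)
  then have "(\<lambda>t. f (x t) - vs - q * y t + e t) \<longlonglongrightarrow> f xs - vs - q * 0 + 0"
    by (intro tendsto_intros y_lim e_lim)
  moreover have "w = (\<lambda>t. f (x t) - vs - q * y t + e t)" by (simp add: e_def fun_eq_iff)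
  ultimately have "w \<longlonglongrightarrow> us" using \<open>f xs = us + vs\<close> by simp
  then have "(\<lambda>t. (x t, w t)) \<longlonglongrightarrow> (xs, us)" by (rule tendsto_Pair[OF x_lim])
  then show ?thesis by (simp add: zt[symmetric])
qed

end
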